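(* $\mathsf{GAP} \leq_{sc} \mathsf{RT}^3_{5,4}$: for every increasing function $g : \omega \to \omega$ there is a coloring $f : [\omega]^3 \to 5$ such that every infinite set $H$ with $|f[H]^3| \leq 4$ computes an infinite $g$-transitive set.
   Context: $[\omega]^3$ is the set of 3-element subsets of $\omega$. Given $g : \omega \to \omega$, an interval $[a,b]$ is $g$-large if $b \geq g(a)$ and $g$-small otherwise. A set $H$ is $g$-transitive if for every $x < y < z$ in $H$ such that $[x,y]$ and $[y,z]$ are $g$-small, $[x,z]$ is $g$-small. *)

theory Defs
  imports Main "HOL-Library.Ramsey" "HOL-Library.Nat_Bijection"
begin

section \<open>Computability relative to an oracle\<close>

text \<open>
  Kleene's partial recursive functions relative to an oracle \<open>g\<close>, presented as programs with a
  big-step semantics. A program without a value on some argument list is undefined there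
  (unbounded search, or wrong arity).
\<close>

datatype prog =
    Zero
  | Succ
  | Proj nat
  | Oracle
  | Comp prog "prog list"
  | PrimRec prog prog
  | Mu prog

inductive eval :: "(nat \<Rightarrow> nat) \<Rightarrow> prog \<Rightarrow> nat list \<Rightarrow> nat \<Rightarrow> bool" for g :: "nat \<Rightarrow> nat" where
  eval_Zero: "eval g Zero xs 0"
| eval_Succ: "eval g Succ [x] (Suc x)"
| eval_Proj: "i < length xs \<Longrightarrow> eval g (Proj i) xs (xs ! i)"
| eval_Oracle: "eval g Oracle [x] (g x)"
| eval_Comp: "list_all2 (\<lambda>q y. eval g q xs y) qs ys \<Longrightarrow> eval g p ys z \<Longrightarrow> eval g (Comp p qs) xs z"
| eval_PrimRec_0: "eval g p xs y \<Longrightarrow> eval g (PrimRec p q) (0 # xs) y"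
| eval_PrimRec_Suc: "eval g (PrimRec p q) (n # xs) r \<Longrightarrow> eval g q (n # r # xs) y
    \<Longrightarrow> eval g (PrimRec p q) (Suc n # xs) y"
| eval_Mu: "eval g p (n # xs) 0 \<Longrightarrow> (\<And>i. i < n \<Longrightarrow> \<exists>k. eval g p (i # xs) (Suc k))
    \<Longrightarrow> eval g (Mu p) xs n"

inductive_cases eval_ZeroE: "eval g Zero xs y"
inductive_cases eval_SuccE: "eval g Succ xs y"
inductive_cases eval_ProjE: "eval g (Proj i) xs y"
inductive_cases eval_OracleE: "eval g Oracle xs y"
inductive_cases eval_CompE: "eval g (Comp p qs) xs y"
inductive_cases eval_PrimRec_0E: "eval g (PrimRec p q) (0 # xs) y"
inductive_cases eval_PrimRec_SucE: "eval g (PrimRec p q) (Suc n # xs) y"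
inductive_cases eval_MuE: "eval g (Mu p) xs y"

lemma eval_deterministic: "eval g p xs y \<Longrightarrow> eval g p xs z \<Longrightarrow> y = z"
proof (induction arbitrary: z rule: eval.induct)
  case (eval_Zero xs)
  then show ?case by (rule eval_ZeroE) simp
next
  case (eval_Succ x)
  then show ?case by (rule eval_SuccE) simp
next
  case (eval_Proj i xs)
  from eval_Proj.prems show ?case by (rule eval_ProjE) simp
next
  case (eval_Oracle x)
  then show ?case by (rule eval_OracleE) simp
next
  case (eval_Comp xs qs ys p z')
  from eval_Comp.prems obtain ys' where
    *: "list_all2 (\<lambda>q y. eval g q xs y) qs ys'" and z: "eval g p ys' z"
    by (rule eval_CompE)
  have "ys ! i = ys' ! i" if "i < length ys" for i
    using list_all2_nthD2[OF eval_Comp.IH(1) that] list_all2_nthD2[OF *, of i] that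
      list_all2_lengthD[OF eval_Comp.IH(1)] list_all2_lengthD[OF *] by simp
  then have "ys = ys'"
    using list_all2_lengthD[OF eval_Comp.IH(1)] list_all2_lengthD[OF *]
    by (intro nth_equalityI) simp_all
  then show ?case using z eval_Comp.IH(2) by simp
next
  case (eval_PrimRec_0 p xs y q)
  from eval_PrimRec_0.prems have "eval g p xs z" by (rule eval_PrimRec_0E)
  then show ?case by (rule eval_PrimRec_0.IH)
next
  case (eval_PrimRec_Suc p q n xs r y)
  from eval_PrimRec_Suc.prems obtain r' where
    "eval g (PrimRec p q) (n # xs) r'" "eval g q (n # r' # xs) z"
    by (rule eval_PrimRec_SucE)
  with eval_PrimRec_Suc.IH show ?case by metis
next
  case (eval_Mu p n xs)
  from eval_Mu.prems have z: "eval g p (z # xs) 0" by (rule eval_MuE)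
  from eval_Mu.prems have lt: "\<forall>i<z. \<exists>k. eval g p (i # xs) (Suc k)"
    by (rule eval_MuE) blast
  have "\<not> z < n" using eval_Mu.IH(2) z by (metis nat.distinct(1))
  moreover have "\<not> n < z" using eval_Mu.IH(1) lt by (metis nat.distinct(1))
  ultimately show ?case by simp
qed

definition turing_le :: "(nat \<Rightarrow> nat) \<Rightarrow> (nat \<Rightarrow> nat) \<Rightarrow> bool" (infix "\<le>\<^sub>T" 50) where
  "f \<le>\<^sub>T g \<longleftrightarrow> (\<exists>p. \<forall>n. eval g p [n] (f n))"

definition char_fun :: "nat set \<Rightarrow> nat \<Rightarrow> nat" where
  "char_fun A n = (if n \<in> A then 1 else 0)"


section \<open>Problems and strong computable reducibility\<close>

text \<open>Instances and solutions are elements of Baire space.\<close>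

record problem =
  is_instance :: "(nat \<Rightarrow> nat) \<Rightarrow> bool"
  is_solution :: "(nat \<Rightarrow> nat) \<Rightarrow> (nat \<Rightarrow> nat) \<Rightarrow> bool"  \<comment> \<open>instance, then solution\<close>

definition sc_reducible :: "problem \<Rightarrow> problem \<Rightarrow> bool" (infix "\<le>\<^sub>s\<^sub>c" 50) where
  "P \<le>\<^sub>s\<^sub>c Q \<longleftrightarrow>
    (\<forall>X. is_instance P X \<longrightarrow>
      (\<exists>Y. is_instance Q Y \<and> Y \<le>\<^sub>T X \<and>
        (\<forall>Z. is_solution Q Y Z \<longrightarrow> (\<exists>W. is_solution P X W \<and> W \<le>\<^sub>T Z))))"


section \<open>Large and small intervals\<close>

definition large :: "(nat \<Rightarrow> nat) \<Rightarrow> nat \<Rightarrow> nat \<Rightarrow> bool" where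
  "large g a b \<longleftrightarrow> b \<ge> g a"

abbreviation small :: "(nat \<Rightarrow> nat) \<Rightarrow> nat \<Rightarrow> nat \<Rightarrow> bool" where
  "small g a b \<equiv> \<not> large g a b"

definition transitive_for :: "(nat \<Rightarrow> nat) \<Rightarrow> nat set \<Rightarrow> bool" where
  "transitive_for g H \<longleftrightarrow>
    (\<forall>x\<in>H. \<forall>y\<in>H. \<forall>z\<in>H. x < y \<and> y < z \<and> small g x y \<and> small g y z \<longrightarrow> small g x z)"

text \<open>
  Increasing is read as non-decreasing. Strictly increasing functions are among the instances,
  so a reduction of this problem also reduces its restriction to them.
\<close>

definition GAP :: problem where
  "GAP = \<lparr>is_instance = (\<lambda>g. mono g),
          is_solution = (\<lambda>g S. \<exists>H. S = char_fun H \<and> infinite H \<and> transitive_for g H)\<rparr>"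


section \<open>Ramsey's theorem with more colors allowed\<close>

definition coloring :: "nat \<Rightarrow> nat \<Rightarrow> (nat set \<Rightarrow> nat) \<Rightarrow> bool" where
  "coloring n k f \<longleftrightarrow> f \<in> [UNIV]\<^bsup>n\<^esup> \<rightarrow> {..<k}"

text \<open>
  An element \<open>c\<close> of Baire space is read as the coloring sending a finite set to the value of \<open>c\<close>
  at its canonical index. Values of \<open>c\<close> at indices of sets of size other than \<open>n\<close> are irrelevant.
\<close>

definition coloring_of :: "(nat \<Rightarrow> nat) \<Rightarrow> nat set \<Rightarrow> nat" where
  "coloring_of c A = c (set_encode A)"

definition RT :: "nat \<Rightarrow> nat \<Rightarrow> nat \<Rightarrow> problem" where
  "RT n k l = \<lparr>is_instance = (\<lambda>c. coloring n k (coloring_of c)),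
               is_solution = (\<lambda>c S. \<exists>H. S = char_fun H \<and> infinite H \<and>
                                card (coloring_of c ` [H]\<^bsup>n\<^esup>) \<le> l)\<rparr>"

end

theory Submission
  imports Defs "HOL-Library.Discrete_Functions"
begin

text \<open>
  For \<open>x < y < z\<close> monotonicity of \<open>g\<close> makes \<open>[x,z]\<close> large as soon as \<open>[x,y]\<close> or \<open>[y,z]\<close> is, so only
  five patterns of small and large intervals occur; they are the colors. Suppose an infinite \<open>H\<close>
  omits one, listed in the order \<open>[x,y]\<close>, \<open>[y,z]\<close>, \<open>[x,z]\<close>. Omitting small-small-large means that
  \<open>H\<close> is transitive. Without small-small-small only consecutive elements of \<open>H\<close> form small
  intervals, so every other element of \<open>H\<close> will do. Without small-large-large, \<open>H\<close> has no small
  interval at all, because \<open>[y,z]\<close> is large for all large \<open>z\<close>. Without large-small-large, \<open>H\<close> has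
  no small interval beyond \<open>g (Min H)\<close>. Omitting large-large-large is impossible.
\<close>

section \<open>Closure properties of total computable functions\<close>

text \<open>One predicate serves all arities: \<open>F\<close> takes the whole argument list, and
  its values on lists of length other than \<open>k\<close> are left open, so \<open>!\<close> and
  \<open>tl\<close> may be used freely.\<close>

definition computable_in :: "(nat \<Rightarrow> nat) \<Rightarrow> nat \<Rightarrow> (nat list \<Rightarrow> nat) \<Rightarrow> bool" where
  "computable_in g k F \<longleftrightarrow> (\<exists>p. \<forall>xs. length xs = k \<longrightarrow> eval g p xs (F xs))"

lemma turing_le_iff_computable_in: "f \<le>\<^sub>T g \<longleftrightarrow> computable_in g 1 (\<lambda>xs. f (xs ! 0))"
proof -
  have "(\<forall>n. eval g p [n] (f n)) \<longleftrightarrow> (\<forall>xs. length xs = 1 \<longrightarrow> eval g p xs (f (xs ! 0)))" for p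
    by (auto simp: length_Suc_conv)
  then show ?thesis unfolding turing_le_def computable_in_def by simp
qed

lemma computable_in_cong:
  "computable_in g k F \<Longrightarrow> (\<And>xs. length xs = k \<Longrightarrow> F xs = F' xs) \<Longrightarrow> computable_in g k F'"
  unfolding computable_in_def by auto

lemma computable_in_proj: "i < k \<Longrightarrow> computable_in g k (\<lambda>xs. xs ! i)"
  unfolding computable_in_def by (blast intro: eval_Proj)

lemma computable_in_comp:
  assumes "computable_in g (length Fs) G" "\<And>F. F \<in> set Fs \<Longrightarrow> computable_in g k F"
  shows "computable_in g k (\<lambda>xs. G (map (\<lambda>F. F xs) Fs))"
proof -
  obtain p where p: "\<And>xs. length xs = length Fs \<Longrightarrow> eval g p xs (G xs)"
    using assms(1) unfolding computable_in_def by blast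
  obtain q where q: "\<And>F xs. F \<in> set Fs \<Longrightarrow> length xs = k \<Longrightarrow> eval g (q F) xs (F xs)"
    using assms(2) unfolding computable_in_def by metis
  have "eval g (Comp p (map q Fs)) xs (G (map (\<lambda>F. F xs) Fs))" if "length xs = k" for xs
    by (rule eval_Comp[where ys = "map (\<lambda>F. F xs) Fs"])
      (auto simp: list.rel_map p q that intro!: list.rel_refl_strong)
  then show ?thesis unfolding computable_in_def by blast
qed

lemma computable_in_comp1:
  assumes "f \<le>\<^sub>T g" "computable_in g k A"
  shows "computable_in g k (\<lambda>xs. f (A xs))"
  using computable_in_comp[of g "[A]" "\<lambda>xs. f (xs ! 0)" k] assms
  by (simp add: turing_le_iff_computable_in)

lemma computable_in_comp2:
  assumes "computable_in g 2 (\<lambda>xs. h (xs ! 0) (xs ! 1))" "computable_in g k A" "computable_in g k B"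
  shows "computable_in g k (\<lambda>xs. h (A xs) (B xs))"
  using computable_in_comp[of g "[A, B]" "\<lambda>xs. h (xs ! 0) (xs ! 1)" k] assms
  by (auto simp: numeral_2_eq_2)

lemma turing_le_oracle: "g \<le>\<^sub>T g"
  unfolding turing_le_def by (blast intro: eval_Oracle)

lemma computable_in_Suc: "computable_in g k A \<Longrightarrow> computable_in g k (\<lambda>xs. Suc (A xs))"
  by (rule computable_in_comp1[where f = Suc]) (unfold turing_le_def, blast intro: eval_Succ)

lemma computable_in_const: "computable_in g k (\<lambda>xs. c)"
proof (induction c)
  case 0
  show ?case unfolding computable_in_def by (blast intro: eval_Zero)
next
  case (Suc c)
  then show ?case by (rule computable_in_Suc)
qed

lemma computable_in_rec:
  assumes "computable_in g k F" "computable_in g (Suc (Suc k)) G"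
  shows "computable_in g (Suc k) (\<lambda>xs. rec_nat (F (tl xs)) (\<lambda>n r. G (n # r # tl xs)) (xs ! 0))"
proof -
  obtain p where p: "\<And>xs. length xs = k \<Longrightarrow> eval g p xs (F xs)"
    using assms(1) unfolding computable_in_def by blast
  obtain q where q: "\<And>xs. length xs = Suc (Suc k) \<Longrightarrow> eval g q xs (G xs)"
    using assms(2) unfolding computable_in_def by blast
  have "eval g (PrimRec p q) (n # xs) (rec_nat (F xs) (\<lambda>n r. G (n # r # xs)) n)"
    if "length xs = k" for n xs
    by (induction n) (auto intro!: eval_PrimRec_0 eval_PrimRec_Suc p q simp: that)
  then have "eval g (PrimRec p q) xs (rec_nat (F (tl xs)) (\<lambda>n r. G (n # r # tl xs)) (xs ! 0))"
    if "length xs = Suc k" for xs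
    using that by (cases xs) auto
  then show ?thesis unfolding computable_in_def by blast
qed

text \<open>The existence hypothesis makes the unbounded search total. Below the least zero all
  values are successors, as \<open>eval_Mu\<close> demands.\<close>

lemma computable_in_Least:
  assumes "computable_in g (Suc k) P" "\<And>xs. length xs = k \<Longrightarrow> \<exists>n. P (n # xs) = 0"
  shows "computable_in g k (\<lambda>xs. LEAST n. P (n # xs) = 0)"
proof -
  obtain p where p: "\<And>xs. length xs = Suc k \<Longrightarrow> eval g p xs (P xs)"
    using assms(1) unfolding computable_in_def by blast
  have "eval g (Mu p) xs (LEAST n. P (n # xs) = 0)" if xs: "length xs = k" for xs
  proof (rule eval_Mu)
    let ?n = "LEAST n. P (n # xs) = 0"
    have "P (?n # xs) = 0" using assms(2)[OF xs] by (rule LeastI_ex)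
    then show "eval g p (?n # xs) 0" using p[of "?n # xs"] xs by simp
    fix i assume "i < ?n"
    then have "P (i # xs) \<noteq> 0" by (rule not_less_Least)
    then show "\<exists>k. eval g p (i # xs) (Suc k)"
      using p[of "i # xs"] xs by (metis length_Cons not0_implies_Suc)
  qed
  then show ?thesis unfolding computable_in_def by blast
qed

section \<open>Case distinction, arithmetic and the binary logarithm\<close>

lemma computable_in_if_zero:
  assumes "computable_in g k C" "computable_in g k A" "computable_in g k B"
  shows "computable_in g k (\<lambda>xs. if C xs = 0 then A xs else B xs)"
proof -
  \<comment> \<open>Recursion on the condition: the arguments are \<open>[C, A, B]\<close>, the base
    value is \<open>A\<close>, and entry 3 of \<open>n # r # [A, B]\<close> is \<open>B\<close>, so
    every successor step returns \<open>B\<close>.\<close>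
  have "computable_in g 3 (\<lambda>xs. rec_nat (tl xs ! 0) (\<lambda>n r. (n # r # tl xs) ! 3) (xs ! 0))"
    using computable_in_rec[of g 2 "\<lambda>xs. xs ! 0" "\<lambda>xs. xs ! 3"]
    by (simp add: computable_in_proj numeral_3_eq_3 numeral_2_eq_2)
  then have "computable_in g k
      (\<lambda>xs. rec_nat (A xs) (\<lambda>n r. B xs) (C xs))"
    using computable_in_comp[of g "[C, A, B]" _ k] assms by (fastforce simp: numeral_3_eq_3)
  moreover have "rec_nat a (\<lambda>n r. b) c = (if c = 0 then a else b)" for a b c :: nat
    by (cases c) auto
  ultimately show ?thesis by simp
qed

lemma computable_in_pred: "computable_in g k A \<Longrightarrow> computable_in g k (\<lambda>xs. A xs - 1)"
proof (rule computable_in_comp1[where f = "\<lambda>n. n - 1"])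
  have "rec_nat 0 (\<lambda>n r. n) m = m - 1" for m :: nat by (cases m) auto
  then show "(\<lambda>n. n - 1) \<le>\<^sub>T g"
    using computable_in_rec[of g 0 "\<lambda>xs. 0" "\<lambda>xs. xs ! 0"]
    by (simp add: turing_le_iff_computable_in computable_in_proj computable_in_const)
qed

lemma computable_in_add:
  "computable_in g k A \<Longrightarrow> computable_in g k B \<Longrightarrow> computable_in g k (\<lambda>xs. A xs + B xs)"
proof (rule computable_in_comp2[where h = "(+)"])
  have rec: "rec_nat b (\<lambda>n r. Suc r) m = m + b" for m b :: nat by (induction m) auto
  show "computable_in g 2 (\<lambda>xs. xs ! 0 + xs ! 1)"
    using computable_in_rec[of g 1 "\<lambda>xs. xs ! 0" "\<lambda>xs. Suc (xs ! 1)"]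
    by (auto elim!: computable_in_cong
        simp: rec nth_tl numeral_2_eq_2 computable_in_proj computable_in_Suc)
qed

lemma computable_in_diff:
  assumes "computable_in g k A" "computable_in g k B"
  shows "computable_in g k (\<lambda>xs. A xs - B xs)"
\<comment> \<open>The recursion iterates the predecessor and runs on the subtrahend, which must
  therefore be the first argument.\<close>
proof (rule computable_in_comp2[where h = "\<lambda>b a. a - b", OF _ assms(2,1)])
  have rec: "rec_nat b (\<lambda>n r. r - 1) m = b - m" for m b :: nat by (induction m) auto
  show "computable_in g 2 (\<lambda>xs. xs ! 1 - xs ! 0)"
    using computable_in_rec[of g 1 "\<lambda>xs. xs ! 0" "\<lambda>xs. xs ! 1 - 1", unfolded nth_Cons_0]
    using computable_in_pred[OF computable_in_proj, of 1 3 g]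
    by (auto elim!: computable_in_cong
        simp: rec[simplified] nth_tl numeral_2_eq_2 numeral_3_eq_3 computable_in_proj)
qed

lemma computable_in_if_less:
  assumes "computable_in g k A" "computable_in g k B" "computable_in g k C" "computable_in g k D"
  shows "computable_in g k (\<lambda>xs. if A xs < B xs then C xs else D xs)"
  \<comment> \<open>Truncated \<open>B - A\<close> vanishes exactly when \<open>A < B\<close> fails,
    so the branches change places.\<close>
  by (rule computable_in_cong[OF computable_in_if_zero[OF computable_in_diff[OF assms(2,1)] assms(4,3)]])
    auto

lemma computable_in_power2: "computable_in g k A \<Longrightarrow> computable_in g k (\<lambda>xs. 2 ^ A xs)"
proof (rule computable_in_comp1[where f = "\<lambda>n. 2 ^ n"])
  have "rec_nat 1 (\<lambda>n r. r + r) m = (2::nat) ^ m" for m :: nat by (induction m) auto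
  then show "(\<lambda>n. 2 ^ n) \<le>\<^sub>T g"
    using computable_in_rec[of g 0 "\<lambda>xs. 1" "\<lambda>xs. xs ! 1 + xs ! 1"]
    by (simp add: turing_le_iff_computable_in computable_in_proj computable_in_const
        computable_in_add)
qed

text \<open>\<open>floor_log n\<close> is the least \<open>i\<close> with
  \<open>n < 2 ^ Suc i\<close>, also for \<open>n = 0\<close>; a truncated difference being zero
  expresses this condition, so unbounded search applies.\<close>

lemma computable_in_floor_log: "computable_in g k A \<Longrightarrow> computable_in g k (\<lambda>xs. floor_log (A xs))"
proof (rule computable_in_comp1[where f = floor_log])
  have least: "(LEAST i. Suc n - 2 ^ Suc i = 0) = floor_log n" for n
  proof (rule Least_equality)
    show "Suc n - 2 ^ Suc (floor_log n) = 0"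
      using floor_log_exp2_gt[of n] by simp
    show "floor_log n \<le> i" if "Suc n - 2 ^ Suc i = 0" for i
    proof (cases "n = 0")
      case False
      then have "(2::nat) ^ floor_log n < 2 ^ Suc i"
        using floor_log_exp2_le[of n] that by simp
      then show ?thesis by (subst (asm) power_strict_increasing_iff) auto
    qed simp
  qed
  have "computable_in g 1 (\<lambda>xs. LEAST i. Suc ((i # xs) ! 1) - 2 ^ Suc ((i # xs) ! 0) = 0)"
  proof (rule computable_in_Least)
    show "computable_in g (Suc 1) (\<lambda>xs. Suc (xs ! 1) - 2 ^ Suc (xs ! 0))"
      by (intro computable_in_diff computable_in_Suc computable_in_power2 computable_in_proj) auto
    show "\<exists>n. Suc ((n # xs) ! 1) - 2 ^ Suc ((n # xs) ! 0) = 0" for xs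
      using floor_log_exp2_gt[of "xs ! 0"] by (intro exI[of _ "floor_log (xs ! 0)"]) simp
  qed
  then show "floor_log \<le>\<^sub>T g"
    using least by (simp add: turing_le_iff_computable_in)
qed

section \<open>Sets decidable from an oracle\<close>

lemma char_fun_Int_le:
  assumes "char_fun A \<le>\<^sub>T g" "char_fun B \<le>\<^sub>T g"
  shows "char_fun (A \<inter> B) \<le>\<^sub>T g"
proof -
  have "computable_in g 1 (\<lambda>xs. if char_fun A (xs ! 0) = 0 then 0 else char_fun B (xs ! 0))"
    using assms
    by (intro computable_in_if_zero computable_in_const) (simp_all add: turing_le_iff_computable_in)
  then show ?thesis
    unfolding turing_le_iff_computable_in by (rule computable_in_cong) (simp add: char_fun_def)
qed

text \<open>The bound \<open>m\<close> is hard-wired into the program, so it may be chosen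
  non-uniformly.\<close>

lemma char_fun_atLeast_le: "char_fun {m..} \<le>\<^sub>T g"
proof -
  have "computable_in g 1 (\<lambda>xs. if xs ! 0 < m then 0 else 1)"
    by (intro computable_in_if_less computable_in_const computable_in_proj) simp
  then show ?thesis
    unfolding turing_le_iff_computable_in by (rule computable_in_cong) (simp add: char_fun_def)
qed

text \<open>A parity bit is carried along by primitive recursion and flipped after each element of
  \<open>H\<close>. Intersecting the set with \<open>H\<close> keeps every other element of
  \<open>H\<close>.\<close>

lemma char_fun_even_rank_le: "char_fun {n. even (card (H \<inter> {..<n}))} \<le>\<^sub>T char_fun H"
proof -
  define E where "E = {n. even (card (H \<inter> {..<n}))}"
  have E_Suc: "char_fun E (Suc n) = (if char_fun H n = 0 then char_fun E n else 1 - char_fun E n)" for n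
  proof (cases "n \<in> H")
    case True
    then have "H \<inter> {..<Suc n} = insert n (H \<inter> {..<n})" by auto
    then show ?thesis using True by (simp add: char_fun_def E_def)
  next
    case False
    then have "H \<inter> {..<Suc n} = H \<inter> {..<n}" by (auto simp: less_Suc_eq)
    then show ?thesis using False by (simp add: char_fun_def E_def)
  qed
  have rec: "rec_nat (Suc 0) (\<lambda>n r. if char_fun H n = 0 then r else Suc 0 - r) n = char_fun E n" for n
  proof (induction n)
    case 0
    show ?case by (simp add: char_fun_def E_def)
  next
    case (Suc n)
    then show ?case by (simp add: E_Suc)
  qed
  have "computable_in (char_fun H) (Suc 0) (\<lambda>xs. rec_nat 1
      (\<lambda>n r. (\<lambda>xs. if char_fun H (xs ! 0) = 0 then xs ! Suc 0 else 1 - xs ! Suc 0) (n # r # tl xs)) (xs ! 0))"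
    by (intro computable_in_rec[where F = "\<lambda>_. 1"] computable_in_if_zero computable_in_diff
        computable_in_const computable_in_proj computable_in_comp1[OF turing_le_oracle]) auto
  then have "computable_in (char_fun H) 1 (\<lambda>xs. char_fun E (xs ! 0))"
    by (simp add: rec cong: if_cong)
  then show ?thesis unfolding turing_le_iff_computable_in E_def .
qed

section \<open>The coloring\<close>

text \<open>The elements of a three-element set are read off its canonical index \<open>2 ^ x + 2 ^ y + 2 ^ z\<close>
  from the largest to the smallest.\<close>

definition gap_color :: "(nat \<Rightarrow> nat) \<Rightarrow> nat \<Rightarrow> nat" where
  "gap_color g n =
    (let z = floor_log n; y = floor_log (n - 2 ^ z); x = floor_log (n - 2 ^ z - 2 ^ y) in
     if y < g x then if z < g y then if z < g x then 0 else 1 else 2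
     else if z < g y then 3 else 4)"

lemma gap_color_less: "gap_color g n < 5"
  by (simp add: gap_color_def Let_def)

lemma gap_color_le: "gap_color g \<le>\<^sub>T g"
  unfolding turing_le_iff_computable_in gap_color_def Let_def
  by (intro computable_in_if_less computable_in_const computable_in_floor_log computable_in_diff
      computable_in_power2 computable_in_proj computable_in_comp1[OF turing_le_oracle]) auto

lemma coloring_gap_color: "coloring 3 5 (coloring_of (gap_color g))"
  by (simp add: coloring_def coloring_of_def gap_color_less)

text \<open>Each of the three powers of two in the index exceeds the sum of the smaller ones, so
  \<open>floor_log\<close> returns the largest remaining exponent.\<close>

lemma gap_color_triple:
  assumes "x < y" "y < z"
  shows "coloring_of (gap_color g) {x, y, z} =
    (if small g x y then if small g y z then if small g x z then 0 else 1 else 2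
     else if small g y z then 3 else 4)"
proof -
  have pow: "(2::nat) ^ a + 2 ^ a \<le> 2 ^ b" if "a < b" for a b :: nat
    using power_increasing[of "Suc a" b "2::nat"] that by simp
  have "(2::nat) ^ x < 2 ^ y" using assms by simp
  then have "(2::nat) ^ y + 2 ^ x < 2 ^ z" using pow[OF assms(2)] by linarith
  with \<open>2 ^ x < 2 ^ y\<close> have "floor_log (2 ^ z + (2 ^ y + 2 ^ x)) = z" "floor_log (2 ^ y + 2 ^ x) = y"
    by (auto intro!: floor_log_eqI)
  moreover have "set_encode {x, y, z} = 2 ^ z + (2 ^ y + 2 ^ x)"
    using assms by (simp add: set_encode_def)
  ultimately show ?thesis
    by (simp add: coloring_of_def gap_color_def large_def not_le)
qed

section \<open>Sets omitting a color\<close>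

lemma gap_solution_of_pairwise_large:
  assumes "\<And>x y. x \<in> G \<Longrightarrow> y \<in> G \<Longrightarrow> x < y \<Longrightarrow> large g x y"
  shows "transitive_for g G"
  using assms unfolding transitive_for_def by blast

text \<open>Of two consecutive elements of \<open>H\<close>, one has an even number of predecessors
  in \<open>H\<close>; such a pair exists above any bound.\<close>

lemma infinite_even_rank:
  fixes H :: "nat set"
  assumes "infinite H"
  shows "infinite (H \<inter> {n. even (card (H \<inter> {..<n}))})"
  unfolding infinite_nat_iff_unbounded
proof
  fix m
  obtain x where x: "x \<in> H" "m < x"
    using assms unfolding infinite_nat_iff_unbounded by blast
  show "\<exists>n>m. n \<in> H \<inter> {n. even (card (H \<inter> {..<n}))}"
  proof (cases "even (card (H \<inter> {..<x}))")
    case True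
    with x show ?thesis by blast
  next
    case False
    define y where "y = (LEAST y. y \<in> H \<and> x < y)"
    have "\<exists>y. y \<in> H \<and> x < y"
      using assms unfolding infinite_nat_iff_unbounded by blast
    then have y: "y \<in> H \<and> x < y" unfolding y_def by (rule LeastI_ex)
    have "w \<le> x" if "w \<in> H" "w < y" for w
      using that(1) not_less_Least[OF that(2)[unfolded y_def]] by auto
    with x y have "H \<inter> {..<y} = insert x (H \<inter> {..<x})"
      by (auto simp: order.strict_iff_order)
    with False have "even (card (H \<inter> {..<y}))" by simp
    with x y show ?thesis by (intro exI[of _ y]) auto
  qed
qed

text \<open>If nothing of \<open>H\<close> lay in between, the ranks of \<open>x\<close> and
  \<open>z\<close> would differ by one and so in parity.\<close>

lemma ex_between_even_rank:
  fixes H :: "nat set"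
  assumes "x \<in> H" "x < z" "even (card (H \<inter> {..<x}))" "even (card (H \<inter> {..<z}))"
  shows "\<exists>y\<in>H. x < y \<and> y < z"
proof (rule ccontr)
  assume "\<not> ?thesis"
  then have "w \<le> x" if "w \<in> H" "w < z" for w
    using that by (meson not_le)
  with assms(1,2) have "H \<inter> {..<z} = insert x (H \<inter> {..<x})"
    by (auto simp: order.strict_iff_order)
  with assms(3,4) show False by simp
qed

lemma gap_solution_if_color_omitted:
  assumes g: "mono g" and H: "infinite H"
    and omit: "card (coloring_of (gap_color g) ` [H]\<^bsup>3\<^esup>) \<le> 4"
  shows "\<exists>G. infinite G \<and> transitive_for g G \<and> char_fun G \<le>\<^sub>T char_fun H"
proof -
  let ?f = "coloring_of (gap_color g)"
  \<comment> \<open>At most four values cannot exhaust five colors, so some color \<open>c\<close>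
    is omitted.\<close>
  have "\<not> {..<5} \<subseteq> ?f ` [H]\<^bsup>3\<^esup>"
  proof
    assume "{..<5} \<subseteq> ?f ` [H]\<^bsup>3\<^esup>"
    moreover have "?f ` [H]\<^bsup>3\<^esup> \<subseteq> {..<5}"
      by (auto simp: coloring_of_def gap_color_less)
    ultimately have "card (?f ` [H]\<^bsup>3\<^esup>) = 5" by (metis card_lessThan subset_antisym)
    with omit show False by simp
  qed
  then obtain c where c: "c < 5" "c \<notin> ?f ` [H]\<^bsup>3\<^esup>" by blast
  have avoid: "c \<noteq> (if small g x y then if small g y z then if small g x z then 0 else 1 else 2
      else if small g y z then 3 else 4)"
    if "x \<in> H" "y \<in> H" "z \<in> H" "x < y" "y < z" for x y z
  proof -
    have "{x, y, z} \<in> [H]\<^bsup>3\<^esup>" using that by (auto simp: nsets_def)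
    with c(2) have "c \<noteq> ?f {x, y, z}" by blast
    then show ?thesis unfolding gap_color_triple[OF that(4,5)] .
  qed
  have ex_large: "\<exists>z\<in>H. y < z \<and> large g y z" for y
    using H unfolding infinite_nat_iff_unbounded large_def
    by (metis le_less_trans less_imp_le linorder_le_cases)
  \<comment> \<open>Monotonicity enters here: \<open>z < g x\<close> gives \<open>y < g x\<close>
    and \<open>z < g y\<close>.\<close>
  have small_mono: "small g x y \<and> small g y z" if "small g x z" "x < y" "y < z" for x y z
    using that monoD[OF g, of x y] by (auto simp: large_def)
  from c(1) consider "c = 0" | "c = 1" | "c = 2" | "c = 3" | "c = 4" by linarith
  then show ?thesis
  proof cases
    \<comment> \<open>Case numbers exceed colors by one. Color 0 is small-small-small: were
      \<open>[x,z]\<close> small, a point \<open>y\<close> of \<open>H\<close> in between would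
      yield a triple of this color.\<close>
    case 1
    let ?G = "H \<inter> {n. even (card (H \<inter> {..<n}))}"
    have "large g x z" if xz: "x \<in> ?G" "z \<in> ?G" "x < z" for x z
    proof -
      obtain y where "y \<in> H" "x < y" "y < z"
        using ex_between_even_rank[of x H z] xz by auto
      then show ?thesis using avoid[of x y z] small_mono[of x z y] xz 1 by (auto split: if_splits)
    qed
    then have "transitive_for g ?G" by (rule gap_solution_of_pairwise_large)
    then show ?thesis
      using infinite_even_rank[OF H] char_fun_Int_le[OF turing_le_oracle char_fun_even_rank_le]
      by blast
  next
    case 2
    then have "transitive_for g H"
      using avoid unfolding transitive_for_def by (metis (full_types))
    with H turing_le_oracle show ?thesis by blast
  next
    case 3
    have "large g x y" if "x \<in> H" "y \<in> H" "x < y" for x y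
    proof -
      \<comment> \<open>With \<open>[y,z]\<close> large, a small \<open>[x,y]\<close> would produce
        color 2.\<close>
      obtain z where "z \<in> H" "y < z" "large g y z" using ex_large by blast
      then show ?thesis using avoid[of x y z] that 3 by (auto split: if_splits)
    qed
    then have "transitive_for g H" by (rule gap_solution_of_pairwise_large)
    with H turing_le_oracle show ?thesis by blast
  next
    case 4
    \<comment> \<open>Any \<open>a\<close> in \<open>H\<close> serves. From \<open>b\<close> on
      every \<open>[a,x]\<close> is large, so a small \<open>[x,y]\<close> there would produce color
      3.\<close>
    obtain a b where ab: "a \<in> H" "b \<in> H" "a < b" "large g a b"
      using ex_large H by (metis finite.emptyI ex_in_conv)
    let ?G = "H \<inter> {b..}"
    have "large g x y" if "x \<in> ?G" "y \<in> ?G" "x < y" for x y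
      using avoid[of a x y] ab that 4 by (auto simp: large_def split: if_splits)
    then have "transitive_for g ?G" by (rule gap_solution_of_pairwise_large)
    moreover have "infinite ?G"
      using H by (simp add: infinite_nat_iff_unbounded) (meson le_trans less_imp_le linorder_le_cases order.strict_trans1)
    ultimately show ?thesis
      using char_fun_Int_le[OF turing_le_oracle char_fun_atLeast_le] by blast
  next
    case 5
    \<comment> \<open>Two successive large steps inside \<open>H\<close> always yield a triple of
      color 4, a contradiction.\<close>
    obtain x where "x \<in> H" using H by (metis finite.emptyI ex_in_conv)
    moreover obtain y where "y \<in> H" "x < y" "large g x y" using ex_large by blast
    moreover obtain z where "z \<in> H" "y < z" "large g y z" using ex_large by blast
    ultimately show ?thesis using avoid[of x y z] 5 by simp
  qed
qed

text \<open>Both conjuncts take the coloring from \<open>gap_color g\<close>; the first also asserts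
  that it is computable from \<open>g\<close>. The reduction is strong because the transitive set is
  computed from \<open>char_fun H\<close> alone.\<close>

theorem theorem5p8:
  "GAP \<le>\<^sub>s\<^sub>c RT 3 5 4 \<and>
   (\<forall>g :: nat \<Rightarrow> nat. mono g \<longrightarrow>
     (\<exists>f :: nat set \<Rightarrow> nat. coloring 3 5 f \<and>
       (\<forall>H :: nat set. infinite H \<and> card (f ` [H]\<^bsup>3\<^esup>) \<le> 4 \<longrightarrow>
         (\<exists>G :: nat set. infinite G \<and> transitive_for g G \<and> char_fun G \<le>\<^sub>T char_fun H))))"
proof (intro conjI allI impI)
  show "GAP \<le>\<^sub>s\<^sub>c RT 3 5 4"
    unfolding sc_reducible_def
  proof (intro allI impI)
    fix g assume "is_instance GAP g"
    then have g: "mono g" by (simp add: GAP_def)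
    show "\<exists>Y. is_instance (RT 3 5 4) Y \<and> Y \<le>\<^sub>T g \<and>
        (\<forall>Z. is_solution (RT 3 5 4) Y Z \<longrightarrow> (\<exists>W. is_solution GAP g W \<and> W \<le>\<^sub>T Z))"
      using coloring_gap_color gap_color_le gap_solution_if_color_omitted[OF g]
      by (intro exI[of _ "gap_color g"]) (fastforce simp: RT_def GAP_def)
  qed
  fix g :: "nat \<Rightarrow> nat" assume "mono g"
  then show "\<exists>f. coloring 3 5 f \<and>
      (\<forall>H. infinite H \<and> card (f ` [H]\<^bsup>3\<^esup>) \<le> 4 \<longrightarrow>
        (\<exists>G. infinite G \<and> transitive_for g G \<and> char_fun G \<le>\<^sub>T char_fun H))"
    using coloring_gap_color gap_solution_if_color_omitted by blast
qed

end
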